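(* Let $(V,d)$ be a compact metric space equipped with a nonnegative Borel regular measure $\mu$ with $\mu(V)<\infty$, let $D$ be a closed subset of the image of $d$, and let $G(V,D)$ be the graph with vertex set $V$ in which $\{x,y\}$ is an edge iff $d(x,y)\in D$. Then $$\vartheta(G(V,D))\ \ge\ \alpha(G(V,D)).$$
   Context: A kernel is a continuous function $K:V\times V\to\mathbb R$; it is symmetric if $K(x,y)=K(y,x)$ and positive if for every $m\ge 0$, all $x_1,\dots,x_m\in V$ and all reals $u_1,\dots,u_m$, $\sum_{i,j}K(x_i,x_j)u_iu_j\ge 0$. Define $$\vartheta(G(V,D))=\sup\Big\{\int_V\int_V K(x,y)\,d\mu(x)\,d\mu(y)\ :\ K \text{ a continuous symmetric positive kernel},\ \int_V K(x,x)\,d\mu(x)=1,\ K(x,y)=0 \text{ whenever } d(x,y)\in D\Big\}.$$ A measurable stable set is a measurable $C\subseteq V$ with no two points $x,y\in C$ satisfying $d(x,y)\in D$; $\alpha(G(V,D))=\sup\{\mu(C): C \text{ measurable stable}\}$. *)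

theory Defs
  imports "HOL-Analysis.Analysis"
begin

text \<open>
  \<open>\<mu>\<close> may live on any sigma-algebra between the Borel sets of \<open>V\<close> and their completion, so both
  plain Borel measures and the measurable sets of a Borel regular outer measure are covered.
\<close>

definition borel_regular_measure_on :: "'a::metric_space set \<Rightarrow> 'a measure \<Rightarrow> bool" where
  "borel_regular_measure_on V \<mu> \<longleftrightarrow>
     space \<mu> = V \<and>
     sets (restrict_space borel V) \<subseteq> sets \<mu> \<and>
     (\<forall>A\<in>sets \<mu>. \<exists>B\<in>sets (restrict_space borel V). A \<subseteq> B \<and> emeasure \<mu> B = emeasure \<mu> A)"

text \<open>
  A graph on vertex set \<open>V\<close> is given by its set of edges \<open>{x, y}\<close>. If \<open>0 \<in> D\<close>, every vertex
  carries a loop \<open>{x, x} = {x}\<close>.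
\<close>

definition distance_graph :: "'a::metric_space set \<Rightarrow> real set \<Rightarrow> 'a set set" where
  "distance_graph V D = {{x, y} | x y. x \<in> V \<and> y \<in> V \<and> dist x y \<in> D}"

lemma distance_graph_iff:
  "{x, y} \<in> distance_graph V D \<longleftrightarrow> x \<in> V \<and> y \<in> V \<and> dist x y \<in> D"
  by (auto simp: distance_graph_def doubleton_eq_iff dist_commute)

definition continuous_kernel :: "'a::topological_space set \<Rightarrow> ('a \<Rightarrow> 'a \<Rightarrow> real) \<Rightarrow> bool" where
  "continuous_kernel V K \<longleftrightarrow> continuous_on (V \<times> V) (\<lambda>(x, y). K x y)"

definition symmetric_kernel :: "'a set \<Rightarrow> ('a \<Rightarrow> 'a \<Rightarrow> real) \<Rightarrow> bool" where
  "symmetric_kernel V K \<longleftrightarrow> (\<forall>x\<in>V. \<forall>y\<in>V. K x y = K y x)"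

definition positive_kernel :: "'a set \<Rightarrow> ('a \<Rightarrow> 'a \<Rightarrow> real) \<Rightarrow> bool" where
  "positive_kernel V K \<longleftrightarrow>
     (\<forall>(m::nat) (x :: nat \<Rightarrow> 'a) (u :: nat \<Rightarrow> real). (\<forall>i<m. x i \<in> V) \<longrightarrow>
        (\<Sum>i<m. \<Sum>j<m. K (x i) (x j) * u i * u j) \<ge> 0)"

definition theta_feasible ::
    "'a::metric_space set \<Rightarrow> 'a set set \<Rightarrow> 'a measure \<Rightarrow> ('a \<Rightarrow> 'a \<Rightarrow> real) set" where
  "theta_feasible V E \<mu> =
     {K. continuous_kernel V K \<and> symmetric_kernel V K \<and> positive_kernel V K \<and>
         (\<integral>x. K x x \<partial>\<mu>) = 1 \<and>
         (\<forall>x\<in>V. \<forall>y\<in>V. {x, y} \<in> E \<longrightarrow> K x y = 0)}"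

text \<open>
  The objective is nonnegative for every positive continuous kernel (and at most \<open>\<mu>(V)\<close> for
  feasible ones), so the supremum is taken in \<open>[0, \<infinity>]\<close>. The only effect of this choice is that
  the supremum is \<open>0\<close> when there is no feasible kernel, as happens if \<open>\<mu>(V) = 0\<close> or \<open>0 \<in> D\<close>.
\<close>

definition theta :: "'a::metric_space set \<Rightarrow> 'a set set \<Rightarrow> 'a measure \<Rightarrow> ennreal" where
  "theta V E \<mu> = (SUP K\<in>theta_feasible V E \<mu>. ennreal (\<integral>y. (\<integral>x. K x y \<partial>\<mu>) \<partial>\<mu>))"

text \<open>The points \<open>x\<close> and \<open>y\<close> need not be distinct; this only matters if \<open>0 \<in> D\<close>.\<close>

definition measurable_stable :: "'a set set \<Rightarrow> 'a measure \<Rightarrow> 'a set \<Rightarrow> bool" where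
  "measurable_stable E \<mu> C \<longleftrightarrow> C \<in> sets \<mu> \<and> (\<forall>x\<in>C. \<forall>y\<in>C. {x, y} \<notin> E)"

definition alpha :: "'a set set \<Rightarrow> 'a measure \<Rightarrow> ennreal" where
  "alpha E \<mu> = (SUP C\<in>{C. measurable_stable E \<mu> C}. emeasure \<mu> C)"

end

theory Submission
  imports Defs
begin

text \<open>
  By inner regularity it suffices to bound \<open>\<mu>(F)\<close> for compact stable \<open>F\<close>. The distances
  realised in \<open>F\<close> form a compact set disjoint from the closed set \<open>D\<close>, so a small neighbourhood
  of \<open>F\<close> is stable as well. For a continuous \<open>f\<close> with values in \<open>[0, 1]\<close>, equal to \<open>1\<close> on \<open>F\<close> and
  supported in that neighbourhood, the kernel \<open>f(x) f(y) / \<integral>f\<^sup>2\<close> is feasible with objective value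
  \<open>(\<integral>f)\<^sup>2 / \<integral>f\<^sup>2 \<ge> \<integral>f \<ge> \<mu>(F)\<close>, because \<open>f\<^sup>2 \<le> f\<close>.
\<close>

section \<open>Closed and open approximation for finite Borel measures\<close>

text \<open>The open sets of points at distance less than \<open>1 / (n + 1)\<close> from
  \<open>A\<close> decrease to \<open>A\<close>, because \<open>A\<close> is closed; continuity from
  above of a finite measure does the rest.\<close>

lemma finite_measure_closed_approx_by_open:
  fixes M :: "'a::metric_space measure"
  assumes fin: "finite_measure M" and borel: "sets M = sets borel" and A: "closed A" and e: "0 < e"
  shows "\<exists>U. open U \<and> A \<subseteq> U \<and> measure M (U - A) < e"
\<comment> \<open>By convention \<open>infdist x {} = 0\<close>, so the neighbourhoods used below
  would not shrink to the empty set.\<close>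
proof (cases "A = {}")
  case True
  with e show ?thesis by (intro exI[of _ "{}"]) auto
next
  case False
  interpret finite_measure M by fact
  define U where "U n = {x. infdist x A < inverse (real (Suc n))}" for n
  have op: "open (U n)" for n
    unfolding U_def by (intro open_Collect_less continuous_intros)
  have sub: "A \<subseteq> U n" for n
    by (auto simp: U_def)
  have dec: "decseq (\<lambda>n. U n - A)"
    unfolding decseq_def U_def
    by (auto elim!: less_le_trans intro!: le_imp_inverse_le)
  have "x \<in> A" if "\<And>n. x \<in> U n" for x
  proof -
    have "infdist x A = 0"
    proof (rule ccontr)
      assume "infdist x A \<noteq> 0"
      then have "infdist x A > 0"
        using infdist_nonneg[of x A] by linarith
      then obtain n where "inverse (real (Suc n)) < infdist x A"
        using reals_Archimedean by blast
      then show False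
        using that[of n] by (simp add: U_def)
    qed
    then show ?thesis
      using A False in_closed_iff_infdist_zero by blast
  qed
  then have "(\<Inter>n. U n - A) = {}"
    by auto
  moreover have "range (\<lambda>n. U n - A) \<subseteq> sets M"
    using borel A op by auto
  ultimately have "(\<lambda>n. measure M (U n - A)) \<longlonglongrightarrow> 0"
    using finite_Lim_measure_decseq[OF _ dec] by (simp only: measure_empty)
  then have "\<forall>\<^sub>F n in sequentially. measure M (U n - A) < e"
    using e by (rule order_tendstoD)
  then obtain n where "measure M (U n - A) < e"
    by (auto simp: eventually_sequentially)
  then show ?thesis
    using op sub by blast
qed

text \<open>The sets with such approximations contain the closed sets and are stable under
  complements, which swap the roles of \<open>F\<close> and \<open>U\<close>, and under countable
  unions. Induction over the sigma-algebra generated by the closed sets therefore reaches every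
  Borel set.\<close>

lemma finite_measure_borel_approx_closed_open:
  fixes M :: "'a::metric_space measure"
  assumes fin: "finite_measure M" and borel: "sets M = sets borel" and A: "A \<in> sets M" and e: "0 < e"
  shows "\<exists>F U. closed F \<and> open U \<and> F \<subseteq> A \<and> A \<subseteq> U \<and> measure M (U - F) < e"
proof -
  interpret finite_measure M by fact
  have "A \<in> sigma_sets UNIV {S. closed S}"
    using A borel by (simp add: borel_eq_closed)
  then show ?thesis
    using e
  proof (induction arbitrary: e)
    case (Basic A)
    then show ?case
      using finite_measure_closed_approx_by_open[OF fin borel, of A e] by blast
  next
    case Empty
    then show ?case
      by (intro exI[of _ "{}"]) simp
  next
    case (Compl A)
    then obtain F U where "closed F" "open U" "F \<subseteq> A" "A \<subseteq> U" "measure M (U - F) < e"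
      by metis
    moreover have "- F - - U = U - F"
      by auto
    ultimately show ?case
      unfolding Compl_eq_Diff_UNIV[symmetric]
      by (intro exI[of _ "- U"] exI[of _ "- F"]) (simp add: closed_Compl open_Compl)
  next
    case (Union A)
    \<comment> \<open>These tolerances sum to \<open>e / 2\<close>; the other half is spent on
      truncating the union of the \<open>F n\<close>.\<close>
    define d where "d n = e / 2 * (1 / 2) ^ Suc n" for n
    have "0 < d n" for n
      using Union.prems by (simp add: d_def)
    then have "\<exists>F U. closed F \<and> open U \<and> F \<subseteq> A n \<and> A n \<subseteq> U \<and> measure M (U - F) < d n" for n
      using Union.IH by blast
    then obtain F U where F: "\<And>n. closed (F n)" "\<And>n. F n \<subseteq> A n"
      and U: "\<And>n. open (U n)" "\<And>n. A n \<subseteq> U n"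
      and FU: "\<And>n. measure M (U n - F n) < d n"
      by metis
    have sets: "F n \<in> sets M" "U n \<in> sets M" for n
      using F(1) U(1) borel by auto
    have d: "d sums (e / 2)"
      unfolding d_def using sums_mult[OF power_half_series, of "e / 2"] by simp
    have summable: "summable (\<lambda>n. measure M (U n - F n))"
      by (rule summable_comparison_test'[OF sums_summable[OF d]]) (simp add: less_imp_le[OF FU])
    have "measure M (\<Union>n. U n - F n) \<le> (\<Sum>n. measure M (U n - F n))"
      using sets summable by (intro finite_measure_subadditive_countably) auto
    also have "\<dots> \<le> e / 2"
      using suminf_le[OF less_imp_le[OF FU] summable sums_summable[OF d]] sums_unique[OF d]
      by simp
    finally have outer: "measure M (\<Union>n. U n - F n) \<le> e / 2" .
    \<comment> \<open>An infinite union of closed sets need not be closed, so only finitely many are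
      kept. \<open>R N\<close> is what this loses, and it decreases to the empty set.\<close>
    define R where "R N = (\<Union>n. F n) - (\<Union>n<N. F n)" for N
    have R: "R N \<in> sets M" for N
      using sets by (auto simp: R_def)
    have "decseq R"
      unfolding decseq_def R_def by (intro allI impI Diff_mono UN_mono) auto
    moreover have "(\<Inter>N. R N) = {}"
      by (auto simp: R_def)
    ultimately have "(\<lambda>N. measure M (R N)) \<longlonglongrightarrow> 0"
      using finite_Lim_measure_decseq[of R] R by auto
    then have "\<forall>\<^sub>F N in sequentially. measure M (R N) < e / 2"
      using Union.prems by (intro order_tendstoD) auto
    then obtain N where N: "measure M (R N) < e / 2"
      by (auto simp: eventually_sequentially)
    \<comment> \<open>A point of \<open>U n\<close> outside the finite union either misses
      \<open>F n\<close>, or lies in \<open>F n\<close> and hence in \<open>R N\<close>.\<close>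
    have "measure M ((\<Union>n. U n) - (\<Union>n<N. F n)) \<le> measure M ((\<Union>n. U n - F n) \<union> R N)"
      using sets R by (intro finite_measure_mono) (auto simp: R_def)
    also have "\<dots> \<le> measure M (\<Union>n. U n - F n) + measure M (R N)"
      using sets R by (intro measure_Un_le) auto
    also have "\<dots> < e"
      using outer N by simp
    finally have "measure M ((\<Union>n. U n) - (\<Union>n<N. F n)) < e" .
    moreover have "closed (\<Union>n<N. F n)" "open (\<Union>n. U n)"
      using F(1) U(1) by auto
    moreover have "(\<Union>n<N. F n) \<subseteq> (\<Union>n. A n)" "(\<Union>n. A n) \<subseteq> (\<Union>n. U n)"
      using F(2) U(2) by blast+
    ultimately show ?case
      by blast
  qed
qed

section \<open>Inner regularity of \<open>\<mu>\<close> on its own sigma-algebra\<close>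

lemma borel_regular_measure_on_ident_measurable:
  assumes "borel_regular_measure_on V \<mu>"
  shows "(\<lambda>x. x) \<in> \<mu> \<rightarrow>\<^sub>M borel"
proof (rule measurableI)
  fix B :: "'a set" assume "B \<in> sets borel"
  then have "V \<inter> B \<in> sets \<mu>"
    using assms by (auto simp: borel_regular_measure_on_def sets_restrict_space)
  then show "(\<lambda>x. x) -` B \<inter> space \<mu> \<in> sets \<mu>"
    using assms by (simp add: borel_regular_measure_on_def Int_commute)
qed simp

text \<open>Regularity provides Borel sets from outside only. Applied to \<open>V - C\<close>, it
  gives a Borel cover of equal measure whose complement in \<open>V\<close> lies inside
  \<open>C\<close>; finiteness of \<open>\<mu>\<close> allows the subtraction.\<close>

lemma borel_regular_measure_on_inner_borel:
  assumes reg: "borel_regular_measure_on V \<mu>" and fin: "finite_measure \<mu>"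
    and borel: "V \<in> sets borel" and C: "C \<in> sets \<mu>"
  shows "\<exists>B\<in>sets borel. B \<in> sets \<mu> \<and> B \<subseteq> C \<and> measure \<mu> B = measure \<mu> C"
proof -
  interpret finite_measure \<mu> by fact
  have V: "space \<mu> = V" and sub: "sets (restrict_space borel V) \<subseteq> sets \<mu>"
    using reg by (auto simp: borel_regular_measure_on_def)
  obtain B where B: "B \<in> sets (restrict_space borel V)" "V - C \<subseteq> B"
      "emeasure \<mu> B = emeasure \<mu> (V - C)"
    using reg sets.compl_sets[OF C] V unfolding borel_regular_measure_on_def by metis
  have "B \<in> sets borel" "B \<in> sets \<mu>"
    using B(1) borel sub by (auto simp: sets_restrict_space)
  moreover have "measure \<mu> (V - B) = measure \<mu> C"
    using finite_measure_compl[of B] finite_measure_compl[of C] B(3) C V \<open>B \<in> sets \<mu>\<close>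
    by (simp add: measure_def)
  moreover have "V - B \<subseteq> C"
    using B(2) by auto
  moreover have "V - B \<in> sets \<mu>"
    using sets.compl_sets[OF \<open>B \<in> sets \<mu>\<close>] V by simp
  ultimately show ?thesis
    using borel by (intro bexI[of _ "V - B"]) auto
qed

lemma borel_regular_measure_on_inner_closed:
  assumes reg: "borel_regular_measure_on V \<mu>" and fin: "finite_measure \<mu>"
    and borel: "V \<in> sets borel" and C: "C \<in> sets \<mu>" and e: "0 < e"
  shows "\<exists>F. closed F \<and> F \<subseteq> C \<and> F \<in> sets \<mu> \<and> measure \<mu> C < measure \<mu> F + e"
proof -
  interpret finite_measure \<mu> by fact
  have V: "space \<mu> = V"
    using reg by (auto simp: borel_regular_measure_on_def)
  have id: "(\<lambda>x. x) \<in> \<mu> \<rightarrow>\<^sub>M borel"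
    by (rule borel_regular_measure_on_ident_measurable[OF reg])
  \<comment> \<open>The approximation lemma speaks of measures on the Borel sets of the whole type,
    so \<open>\<mu>\<close> is pushed forward along the inclusion. Both measures agree on Borel
    subsets of \<open>V\<close>.\<close>
  define N where "N = distr \<mu> borel (\<lambda>x. x)"
  interpret N: finite_measure N
    unfolding N_def by (rule finite_measure_distr[OF id])
  have sets_N: "sets N = sets borel"
    by (simp add: N_def)
  obtain B where B: "B \<in> sets borel" "B \<in> sets \<mu>" "B \<subseteq> C" "measure \<mu> B = measure \<mu> C"
    using borel_regular_measure_on_inner_borel[OF reg fin borel C] by blast
  obtain F U where FU: "closed F" "open U" "F \<subseteq> B" "B \<subseteq> U" "measure N (U - F) < e"
    using finite_measure_borel_approx_closed_open[OF N.finite_measure_axioms sets_N _ e] B(1) sets_N by metis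
  have F: "F \<in> sets \<mu>"
  proof -
    have "(\<lambda>x. x) -` F \<inter> space \<mu> \<in> sets \<mu>"
      using id FU(1) by (intro measurable_sets) auto
    moreover have "F \<subseteq> space \<mu>"
      using FU(3) sets.sets_into_space[OF B(2)] by auto
    ultimately show ?thesis
      by (simp add: Int_absorb2)
  qed
  have BF: "B - F \<in> sets borel" "B - F \<subseteq> space \<mu>"
    using B(1) FU(1) sets.sets_into_space[OF B(2)] by auto
  have "measure \<mu> (B - F) = measure N (B - F)"
    using BF by (simp add: N_def measure_distr[OF id] Int_absorb2)
  also have "\<dots> \<le> measure N (U - F)"
    using FU B(1) by (intro N.finite_measure_mono) (auto simp: sets_N)
  also have "\<dots> < e"
    by fact
  finally have "measure \<mu> B - measure \<mu> F < e"
    using finite_measure_Diff[OF B(2) F FU(3)] by simp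
  then show ?thesis
    using FU B F by (intro exI[of _ F]) auto
qed

section \<open>A feasible kernel from a compact stable set\<close>

text \<open>The quadratic form is the square of the sum of the \<open>f (x i) * u i\<close>, divided
  by \<open>c\<close>.\<close>

lemma rank_one_positive_kernel:
  assumes "0 < c"
  shows "positive_kernel V (\<lambda>x y. f x * f y / c)"
  unfolding positive_kernel_def
proof (intro allI impI)
  fix m :: nat and x :: "nat \<Rightarrow> 'a" and u :: "nat \<Rightarrow> real"
  have "(\<Sum>i<m. \<Sum>j<m. f (x i) * f (x j) / c * u i * u j) = (\<Sum>i<m. f (x i) * u i)\<^sup>2 / c"
    by (simp add: power2_eq_square sum_product sum_divide_distrib mult_ac)
  then show "0 \<le> (\<Sum>i<m. \<Sum>j<m. f (x i) * f (x j) / c * u i * u j)"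
    using assms by simp
qed

text \<open>The compact set of distances in \<open>F\<close> has a positive gap
  \<open>\<epsilon>\<close> to \<open>D\<close>. Moving each endpoint by less than
  \<open>\<epsilon> / 2\<close> changes a distance by less than \<open>\<epsilon>\<close>.\<close>

lemma compact_stable_neighbourhood:
  fixes F :: "'a::metric_space set" and D :: "real set"
  assumes F: "compact F" and D: "closed D" and stable: "\<And>x y. x \<in> F \<Longrightarrow> y \<in> F \<Longrightarrow> dist x y \<notin> D"
  shows "\<exists>\<delta>>0. \<forall>a\<in>F. \<forall>b\<in>F. \<forall>x y. dist x a < \<delta> \<longrightarrow> dist y b < \<delta> \<longrightarrow> dist x y \<notin> D"
proof -
  have "compact ((\<lambda>(x, y). dist x y) ` (F \<times> F))"
    using F by (intro compact_continuous_image compact_Times)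
      (auto simp: case_prod_unfold intro!: continuous_intros)
  moreover have "(\<lambda>(x, y). dist x y) ` (F \<times> F) \<inter> D = {}"
    using stable by auto
  ultimately obtain \<epsilon> where \<epsilon>: "0 < \<epsilon>"
      "\<forall>s\<in>(\<lambda>(x, y). dist x y) ` (F \<times> F). \<forall>t\<in>D. \<epsilon> \<le> dist s t"
    using separate_compact_closed D by blast
  have "dist x y \<notin> D" if "a \<in> F" "b \<in> F" "dist x a < \<epsilon> / 2" "dist y b < \<epsilon> / 2" for a b x y
  proof
    assume "dist x y \<in> D"
    then have "\<epsilon> \<le> dist (dist a b) (dist x y)"
      using \<epsilon>(2) that by auto
    then have "\<epsilon> \<le> \<bar>dist a b - dist x y\<bar>"
      by (simp add: dist_real_def)
    moreover have "dist a b \<le> dist x a + dist x y + dist y b"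
      using dist_triangle[of a b x] dist_triangle[of x b y] by (simp add: dist_commute)
    moreover have "dist x y \<le> dist x a + dist a b + dist y b"
      using dist_triangle[of x y a] dist_triangle[of a y b] by (simp add: dist_commute)
    ultimately show False
      using that by linarith
  qed
  then show ?thesis
    using \<epsilon>(1) by (intro exI[of _ "\<epsilon> / 2"]) auto
qed

lemma emeasure_compact_stable_le_theta:
  fixes V :: "'a::metric_space set" and D :: "real set"
  assumes reg: "borel_regular_measure_on V \<mu>" and fin: "finite_measure \<mu>"
    and D: "closed D" and F: "compact F" "F \<in> sets \<mu>"
    and stable: "\<And>x y. x \<in> F \<Longrightarrow> y \<in> F \<Longrightarrow> dist x y \<notin> D"
  shows "emeasure \<mu> F \<le> theta V (distance_graph V D) \<mu>"
\<comment> \<open>For a null set the bound is trivial, whereas the normalising constant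
  \<open>c\<close> below could vanish.\<close>
proof (cases "measure \<mu> F = 0")
  case True
  then show ?thesis
    using finite_measure.emeasure_eq_measure[OF fin] by simp
next
  case False
  interpret finite_measure \<mu> by fact
  have pos: "0 < measure \<mu> F"
    using False by (simp add: zero_less_measure_iff)
  then have ne: "F \<noteq> {}"
    by auto
  obtain \<delta> where \<delta>: "0 < \<delta>"
    "\<And>a b x y. a \<in> F \<Longrightarrow> b \<in> F \<Longrightarrow> dist x a < \<delta> \<Longrightarrow> dist y b < \<delta> \<Longrightarrow> dist x y \<notin> D"
    using compact_stable_neighbourhood[OF F(1) D stable] by blast
  \<comment> \<open>An explicit continuous cutoff, zero as soon as the distance to \<open>F\<close>
    is at least \<open>\<delta>\<close>.\<close>
  define f where "f x = max 0 (1 - infdist x F / \<delta>)" for x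
  have cont: "continuous_on UNIV f"
    unfolding f_def using \<delta>(1) by (intro continuous_intros) auto
  have f0: "0 \<le> f x" and f1: "f x \<le> 1" for x
    using \<delta>(1) by (auto simp: f_def infdist_nonneg)
  have f_F: "f x = 1" if "x \<in> F" for x
    using that by (simp add: f_def)
  have near: "\<exists>a\<in>F. dist x a < \<delta>" if "f x \<noteq> 0" for x
  proof -
    have "infdist x F < \<delta>"
      using that \<delta>(1) by (auto simp: f_def max_def field_simps split: if_splits)
    then show ?thesis
      using ne by (auto simp: infdist_def cINF_less_iff)
  qed
  have meas [measurable]: "f \<in> borel_measurable \<mu>"
    using measurable_compose[OF borel_regular_measure_on_ident_measurable[OF reg]
        borel_measurable_continuous_onI[OF cont]] .
  have int: "integrable \<mu> f" "integrable \<mu> (\<lambda>x. f x * f x)"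
    using f0 f1 by (auto intro!: integrable_const_bound[where B = 1] simp: mult_le_one)
  define c where "c = (\<integral>x. f x * f x \<partial>\<mu>)"
  define I where "I = (\<integral>x. f x \<partial>\<mu>)"
  \<comment> \<open>Integrating this gives \<open>measure \<mu> F \<le> c\<close>, which also makes
    \<open>c\<close> positive.\<close>
  have ind: "indicator F x \<le> f x * f x" for x
    using f0[of x] by (auto simp: indicator_def f_F)
  have "measure \<mu> F = (\<integral>x. indicator F x \<partial>\<mu>)"
    using F(2) sets.sets_into_space[OF F(2)] by (simp add: Int_absorb2)
  also have "\<dots> \<le> c"
    unfolding c_def using F(2) ind int
    by (intro integral_mono) (auto simp: emeasure_eq_measure)
  finally have Fc: "measure \<mu> F \<le> c" .
  have cI: "c \<le> I"
    unfolding c_def I_def using f0 f1 int by (intro integral_mono) (auto simp: mult_left_le)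
  have c: "0 < c"
    using Fc pos by linarith
  define K where "K x y = f x * f y / c" for x y
  have "continuous_kernel V K"
    unfolding continuous_kernel_def K_def case_prod_unfold using c
    by (intro continuous_intros continuous_on_compose2[OF cont]) auto
  moreover have "symmetric_kernel V K"
    by (simp add: symmetric_kernel_def K_def)
  moreover have "positive_kernel V K"
    unfolding K_def by (rule rank_one_positive_kernel[OF c])
  moreover have "(\<integral>x. K x x \<partial>\<mu>) = 1"
    unfolding K_def using c by (simp add: c_def)
  moreover have "K x y = 0" if "{x, y} \<in> distance_graph V D" for x y
  proof (rule ccontr)
    assume "K x y \<noteq> 0"
    then have "f x \<noteq> 0" "f y \<noteq> 0"
      by (auto simp: K_def)
    then obtain a b where "a \<in> F" "b \<in> F" "dist x a < \<delta>" "dist y b < \<delta>"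
      using near by blast
    then show False
      using \<delta>(2) that by (auto simp: distance_graph_iff)
  qed
  ultimately have "K \<in> theta_feasible V (distance_graph V D) \<mu>"
    by (simp add: theta_feasible_def)
  then have "ennreal (\<integral>y. (\<integral>x. K x y \<partial>\<mu>) \<partial>\<mu>) \<le> theta V (distance_graph V D) \<mu>"
    unfolding theta_def by (rule SUP_upper)
  moreover have "(\<integral>y. (\<integral>x. K x y \<partial>\<mu>) \<partial>\<mu>) = I * I / c"
    by (simp add: K_def I_def)
  moreover have "measure \<mu> F \<le> I * I / c"
  proof -
    \<comment> \<open>Both factors on the left are at most \<open>I\<close>, since
      \<open>measure \<mu> F \<le> c \<le> I\<close>.\<close>
    have "measure \<mu> F * c \<le> I * I"
      using Fc cI c pos by (intro mult_mono) auto
    then show ?thesis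
      using c by (simp add: pos_le_divide_eq)
  qed
  ultimately show ?thesis
    by (metis emeasure_eq_measure ennreal_leI order_trans)
qed

section \<open>From compact stable sets to measurable ones\<close>

theorem theorem4p1:
  fixes V :: "'a::metric_space set" and \<mu> :: "'a measure" and D :: "real set"
  assumes "compact V"
    and "borel_regular_measure_on V \<mu>"
    and "emeasure \<mu> V < \<infinity>"
    and "closed D"
    and "D \<subseteq> (\<lambda>(x, y). dist x y) ` (V \<times> V)"
  shows "theta V (distance_graph V D) \<mu> \<ge> alpha (distance_graph V D) \<mu>"
proof -
  have V: "space \<mu> = V"
    using assms(2) by (simp add: borel_regular_measure_on_def)
  have fin: "finite_measure \<mu>"
    using assms(3) V by (intro finite_measureI) auto
  interpret finite_measure \<mu> by (fact fin)
  have borel: "V \<in> sets borel"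
    using assms(1) by (intro borel_closed compact_imp_closed)
  show ?thesis
    unfolding alpha_def
  proof (rule SUP_least)
    fix C assume "C \<in> {C. measurable_stable (distance_graph V D) \<mu> C}"
    then have C: "C \<in> sets \<mu>" and edge: "\<And>x y. x \<in> C \<Longrightarrow> y \<in> C \<Longrightarrow> {x, y} \<notin> distance_graph V D"
      by (auto simp: measurable_stable_def)
    have CV: "C \<subseteq> V"
      using sets.sets_into_space[OF C] V by simp
    show "emeasure \<mu> C \<le> theta V (distance_graph V D) \<mu>"
    \<comment> \<open>Closed subsets exhaust the measure of \<open>C\<close> only up to an
      arbitrarily small error.\<close>
    proof (rule ennreal_le_epsilon)
      fix e :: real assume "0 < e"
      then obtain F where F: "closed F" "F \<subseteq> C" "F \<in> sets \<mu>" "measure \<mu> C < measure \<mu> F + e"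
        using borel_regular_measure_on_inner_closed[OF assms(2) fin borel C] by blast
      have "compact F"
        using compact_Int_closed[OF assms(1) F(1)] F(2) CV by (simp add: Int_absorb1)
      \<comment> \<open>An edge also requires its endpoints to lie in \<open>V\<close>, so
        \<open>C \<subseteq> V\<close> is what turns a missing edge into a distance outside
        \<open>D\<close>.\<close>
      moreover have "dist x y \<notin> D" if "x \<in> F" "y \<in> F" for x y
        using edge[of x y] that F(2) CV by (auto simp: distance_graph_iff)
      ultimately have "emeasure \<mu> F \<le> theta V (distance_graph V D) \<mu>"
        using emeasure_compact_stable_le_theta[OF assms(2) fin assms(4)] F(3) by blast
      moreover have "emeasure \<mu> C \<le> emeasure \<mu> F + ennreal e"
        using F(4) \<open>0 < e\<close> by (simp add: emeasure_eq_measure flip: ennreal_plus)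
      ultimately show "emeasure \<mu> C \<le> theta V (distance_graph V D) \<mu> + ennreal e"
        by (meson add_right_mono order_trans)
    qed
  qed
qed

end
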